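(* For every (finite) tree $T$ and every integer $k\ge 0$, $\ddot{\gamma}_P^k(T) = (k+1)\operatorname{sp}(T)$.
   Context: Graphs are finite and simple, with at least one vertex. For a vertex $v$, $N[v]$ denotes its closed neighborhood. The power domination process on a graph $G$ with initial set $S\subseteq V(G)$: (1) set $B=\bigcup_{v\in S}N[v]$; (2) while there is $v\in B$ with exactly one neighbor $u\notin B$, add $u$ to $B$. A set $S$ is a power dominating set of $G$ if $B=V(G)$ when the process terminates. A multiset of vertices is called a power dominating set if its underlying set is one. For an integer $k\ge 0$, a $k$-robust power dominating set of $G$ is a finite multiset $S$ of elements of $V(G)$ with $|S|\ge k$ (counted with multiplicity) such that for every submultiset $F$ of $S$ with $|F|=k$, the multiset difference $S\setminus F$ is a power dominating set of $G$. $\ddot{\gamma}_P^k(G)$ denotes the minimum cardinality (with multiplicity) of a $k$-robust power dominating set of $G$. A tree is an acyclic connected graph. A spider is a tree with at most one vertex of degree 3 or more. A spider cover of a tree $T$ is a partition $\{V_1,\dots,V_\ell\}$ of $V(T)$ such that each induced subgraph $T[V_i]$ is a spider. The spider number $\operatorname{sp}(T)$ is the minimum number of parts in a spider cover of $T$. *)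

theory Defs
  imports "HOL-Library.Multiset" "HOL-Library.Disjoint_Sets"
begin

text \<open>
  A graph is given by its vertex set \<open>V\<close> and its set \<open>E\<close> of undirected edges, each edge being a
  two-element set of vertices.
\<close>

definition simple_graph :: "'a set \<Rightarrow> 'a set set \<Rightarrow> bool" where
  "simple_graph V E \<longleftrightarrow> finite V \<and> V \<noteq> {} \<and> (\<forall>e\<in>E. e \<subseteq> V \<and> card e = 2)"

definition nbhd :: "'a set set \<Rightarrow> 'a \<Rightarrow> 'a set" where
  "nbhd E v = {u. {v, u} \<in> E}"

definition closed_nbhd :: "'a set set \<Rightarrow> 'a \<Rightarrow> 'a set" where
  "closed_nbhd E v = insert v (nbhd E v)"

definition vertex_degree :: "'a set set \<Rightarrow> 'a \<Rightarrow> nat" where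
  "vertex_degree E v = card (nbhd E v)"

definition induced_edges :: "'a set set \<Rightarrow> 'a set \<Rightarrow> 'a set set" where
  "induced_edges E U = {e \<in> E. e \<subseteq> U}"

definition connected_graph :: "'a set \<Rightarrow> 'a set set \<Rightarrow> bool" where
  "connected_graph V E \<longleftrightarrow> (\<forall>u\<in>V. \<forall>v\<in>V. (u, v) \<in> {(x, y). {x, y} \<in> E}\<^sup>*)"

definition is_cycle :: "'a set set \<Rightarrow> 'a list \<Rightarrow> bool" where
  "is_cycle E vs \<longleftrightarrow> 3 \<le> length vs \<and> distinct vs \<and>
     (\<forall>i<length vs. {vs ! i, vs ! (Suc i mod length vs)} \<in> E)"

definition is_tree :: "'a set \<Rightarrow> 'a set set \<Rightarrow> bool" where
  "is_tree V E \<longleftrightarrow> simple_graph V E \<and> connected_graph V E \<and> (\<nexists>vs. is_cycle E vs)"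

definition is_spider :: "'a set \<Rightarrow> 'a set set \<Rightarrow> bool" where
  "is_spider V E \<longleftrightarrow> is_tree V E \<and> card {v \<in> V. 3 \<le> vertex_degree E v} \<le> 1"

definition spider_cover :: "'a set \<Rightarrow> 'a set set \<Rightarrow> 'a set set \<Rightarrow> bool" where
  "spider_cover V E P \<longleftrightarrow> partition_on V P \<and> (\<forall>U\<in>P. is_spider U (induced_edges E U))"

text \<open>
  The two minima below are taken over nonempty sets of numbers when \<open>V\<close> is finite and nonempty:
  the partition into singletons is a spider cover, and \<open>k + 1\<close> copies of every vertex form a
  \<open>k\<close>-robust power dominating set.
\<close>

definition spider_number :: "'a set \<Rightarrow> 'a set set \<Rightarrow> nat" where
  "spider_number V E = (LEAST n. \<exists>P. spider_cover V E P \<and> card P = n)"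

definition forcing_step :: "'a set set \<Rightarrow> 'a set \<Rightarrow> 'a set \<Rightarrow> bool" where
  "forcing_step E B B' \<longleftrightarrow> (\<exists>v\<in>B. \<exists>u. nbhd E v - B = {u} \<and> B' = insert u B)"

text \<open>
  A forcing step involves a choice of the forcing vertex, so the process is a relation:
  \<open>power_domination_result E S B\<close> states that some run started from \<open>S\<close> terminates with
  the set \<open>B\<close>. The order of the forcing steps is irrelevant; see
  \<open>power_domination_result_unique\<close>.
\<close>

definition power_domination_result :: "'a set set \<Rightarrow> 'a set \<Rightarrow> 'a set \<Rightarrow> bool" where
  "power_domination_result E S B \<longleftrightarrow>
     (forcing_step E)\<^sup>*\<^sup>* (\<Union>v\<in>S. closed_nbhd E v) B \<and> (\<nexists>B'. forcing_step E B B')"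

lemma forcing_reaches_subset:
  assumes "(forcing_step E)\<^sup>*\<^sup>* A C" "A \<subseteq> B" "\<nexists>B'. forcing_step E B B'"
  shows "C \<subseteq> B"
  using assms(1,2)
proof (induction rule: rtranclp_induct)
  case (step C D)
  from step.hyps(2) obtain v u where *: "v \<in> C" "nbhd E v - C = {u}" "D = insert u C"
    by (auto simp: forcing_step_def)
  have "u \<in> B"
  proof (rule ccontr)
    assume "u \<notin> B"
    with * step.IH[OF step.prems] have "v \<in> B" "nbhd E v - B = {u}" by blast+
    with assms(3) show False by (auto simp: forcing_step_def)
  qed
  with * step.IH[OF step.prems] show ?case by blast
qed simp

lemma forcing_step_extensive: "(forcing_step E)\<^sup>*\<^sup>* A C \<Longrightarrow> A \<subseteq> C"
  by (induction rule: rtranclp_induct) (auto simp: forcing_step_def)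

lemma power_domination_result_unique:
  assumes "power_domination_result E S B" "power_domination_result E S C"
  shows "B = C"
  using assms unfolding power_domination_result_def
  by (meson forcing_reaches_subset forcing_step_extensive subset_antisym)

definition power_dominating :: "'a set \<Rightarrow> 'a set set \<Rightarrow> 'a set \<Rightarrow> bool" where
  "power_dominating V E S \<longleftrightarrow> S \<subseteq> V \<and> power_domination_result E S V"

definition robust_power_dominating :: "'a set \<Rightarrow> 'a set set \<Rightarrow> nat \<Rightarrow> 'a multiset \<Rightarrow> bool" where
  "robust_power_dominating V E k S \<longleftrightarrow> set_mset S \<subseteq> V \<and> k \<le> size S \<and>
     (\<forall>F. F \<subseteq># S \<and> size F = k \<longrightarrow> power_dominating V E (set_mset (S - F)))"

definition robust_power_domination_number :: "'a set \<Rightarrow> 'a set set \<Rightarrow> nat \<Rightarrow> nat" where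
  "robust_power_domination_number V E k =
     (LEAST n. \<exists>S. robust_power_dominating V E k S \<and> size S = n)"

end

theory Submission
  imports Defs
begin

text \<open>
  Call a nonempty set \<open>F\<close> of vertices a fort if no vertex outside \<open>F\<close> has exactly one neighbour
  in \<open>F\<close>. The complement of a stalled observed set is a fort, so \<open>S\<close> is power dominating iff it meets
  the closed neighbourhood of every fort. Hence a \<open>k\<close>-robust set meets each of these
  neighbourhoods at least \<open>k + 1\<close> times, and \<open>k + 1\<close> copies of a power dominating set are
  \<open>k\<close>-robust. The theorem is thus a min-max statement for a tree: the closed neighbourhoods of
  suitable forts are pairwise disjoint, and there are as many of them as spiders in some spider cover.

  Root the tree. One bottom-up pass picks the centers; each of them yields both a fort and a
  spider. Conversely, the centers of any spider cover form a power dominating set: a fort avoiding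
  their closed neighbourhoods would have to escape from each spider it meets into another one,
  ever further down the tree.
\<close>

section \<open>Forts as obstructions to power domination\<close>

definition fort :: "'a set \<Rightarrow> 'a set set \<Rightarrow> 'a set \<Rightarrow> bool" where
  "fort V E F \<longleftrightarrow> F \<noteq> {} \<and> F \<subseteq> V \<and> (\<forall>v. v \<notin> F \<longrightarrow> (\<nexists>u. nbhd E v \<inter> F = {u}))"

text \<open>A vertex forcing \<open>u\<close> into a still unobserved fort would have
  \<open>u\<close> as its only unobserved neighbour, hence as its only neighbour in the
  fort.\<close>

lemma forcing_avoids_fort:
  assumes "(forcing_step E)\<^sup>*\<^sup>* A B" "fort V E F" "A \<inter> F = {}"
  shows "B \<inter> F = {}"
  using assms(1)
proof (induction rule: rtranclp_induct)
  case (step B C)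
  from step.hyps(2) obtain v u where *: "v \<in> B" "nbhd E v - B = {u}" "C = insert u B"
    by (auto simp: forcing_step_def)
  have "u \<notin> F"
  proof
    assume "u \<in> F"
    with * step.IH have "v \<notin> F" "nbhd E v \<inter> F = {u}" by blast+
    with assms(2) show False by (auto simp: fort_def)
  qed
  with * step.IH show ?case by blast
qed (use assms(3) in simp)

lemma forcing_terminates:
  assumes "simple_graph V E" "A \<subseteq> V"
  obtains B where "(forcing_step E)\<^sup>*\<^sup>* A B" "B \<subseteq> V" "\<nexists>B'. forcing_step E B B'"
proof -
  have finV: "finite V" and EV: "\<And>e. e \<in> E \<Longrightarrow> e \<subseteq> V"
    using assms(1) by (auto simp: simple_graph_def)
  define R where "R = {B. (forcing_step E)\<^sup>*\<^sup>* A B \<and> B \<subseteq> V}"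
  have "finite R" "R \<noteq> {}"
    using finV assms(2) by (auto simp: R_def intro: finite_subset[OF _ finite_Pow_iff[THEN iffD2]])
  then obtain B where B: "B \<in> R" and max: "\<And>C. C \<in> R \<Longrightarrow> B \<subseteq> C \<Longrightarrow> C = B"
    using finite_has_maximal by (metis (no_types, lifting))
  have "\<not> forcing_step E B C" for C
  proof
    assume C: "forcing_step E B C"
    then obtain v u where *: "nbhd E v - B = {u}" "C = insert u B"
      by (auto simp: forcing_step_def)
    have "u \<in> V" using * EV by (fastforce simp: nbhd_def)
    with * B C have "C \<in> R" by (auto simp: R_def)
    with max * show False by blast
  qed
  with B that show thesis by (auto simp: R_def)
qed

lemma power_dominating_iff_meets_forts:
  assumes G: "simple_graph V E"
  shows "power_dominating V E S \<longleftrightarrow>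
    S \<subseteq> V \<and> (\<forall>F. fort V E F \<longrightarrow> (\<exists>v\<in>S. closed_nbhd E v \<inter> F \<noteq> {}))" (is "?L \<longleftrightarrow> ?R")
proof
  assume ?L
  then have S: "S \<subseteq> V" "(forcing_step E)\<^sup>*\<^sup>* (\<Union>v\<in>S. closed_nbhd E v) V"
    by (auto simp: power_dominating_def power_domination_result_def)
  show ?R
  proof (intro conjI allI impI S(1))
    fix F assume F: "fort V E F"
    then have "V \<inter> F \<noteq> {}" by (auto simp: fort_def)
    with forcing_avoids_fort[OF S(2) F] show "\<exists>v\<in>S. closed_nbhd E v \<inter> F \<noteq> {}" by blast
  qed
next
  assume R: ?R
  have EV: "\<And>v u. u \<in> nbhd E v \<Longrightarrow> u \<in> V \<and> v \<in> V"
    using G by (auto simp: simple_graph_def nbhd_def)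
  then have "(\<Union>v\<in>S. closed_nbhd E v) \<subseteq> V" using R by (auto simp: closed_nbhd_def)
  from forcing_terminates[OF G this] obtain B where
    B: "(forcing_step E)\<^sup>*\<^sup>* (\<Union>v\<in>S. closed_nbhd E v) B" "B \<subseteq> V" "\<nexists>B'. forcing_step E B B'" .
  have "B = V"
  proof (rule ccontr)
    assume "B \<noteq> V"
    have "\<nexists>u. nbhd E v \<inter> (V - B) = {u}" if "v \<notin> V - B" for v
    proof
      assume "\<exists>u. nbhd E v \<inter> (V - B) = {u}"
      then obtain u where u: "nbhd E v \<inter> (V - B) = {u}" ..
      with EV[of _ v] that have "v \<in> B" "nbhd E v - B = {u}" by blast+
      with B(3) show False by (auto simp: forcing_step_def)
    qed
    with B(2) \<open>B \<noteq> V\<close> have "fort V E (V - B)" by (auto simp: fort_def)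
    with R obtain v where "v \<in> S" "closed_nbhd E v \<inter> (V - B) \<noteq> {}" by blast
    with forcing_step_extensive[OF B(1)] show False by blast
  qed
  with B R show ?L by (auto simp: power_dominating_def power_domination_result_def)
qed

section \<open>Robust sets and multiplicities\<close>

text \<open>Each vertex of \<open>K\<close> occurs \<open>k + 1\<close> times, so \<open>k\<close>
  deletions leave a copy of every one.\<close>

lemma robust_repeat_mset:
  assumes G: "simple_graph V E" and K: "power_dominating V E K"
  shows "robust_power_dominating V E k (repeat_mset (k + 1) (mset_set K))"
  unfolding robust_power_dominating_def
proof (intro conjI allI impI)
  let ?S = "repeat_mset (k + 1) (mset_set K)"
  have KV: "K \<subseteq> V" using K by (simp add: power_dominating_def)
  then have finK: "finite K" using G by (auto simp: simple_graph_def intro: finite_subset)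
  \<comment> \<open>\<open>V\<close> itself is a fort, so \<open>K\<close> is nonempty, as the bound
    on the size requires.\<close>
  have "fort V E V" using G by (fastforce simp: fort_def simple_graph_def nbhd_def)
  then have "K \<noteq> {}" using K power_dominating_iff_meets_forts[OF G] by blast
  then have "card K \<ge> 1" using finK by (simp add: Suc_leI card_gt_0_iff)
  then have "(k + 1) * 1 \<le> (k + 1) * card K" by (rule mult_le_mono2)
  then show "k \<le> size ?S" by simp
  have mem: "x \<in># ?S \<longleftrightarrow> x \<in> K" for x
    unfolding count_greater_zero_iff[symmetric] using finK by (simp add: count_mset_set')
  then show "set_mset ?S \<subseteq> V" using KV by blast
  fix F assume F: "F \<subseteq># ?S \<and> size F = k"
  have "x \<in># ?S - F \<longleftrightarrow> x \<in> K" for x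
  proof
    assume "x \<in> K"
    then have "count ?S x = k + 1" using finK by simp
    moreover have "count F x \<le> k" using F by (metis count_le_size)
    ultimately have "count (?S - F) x > 0" by (simp only: count_diff)
    then show "x \<in># ?S - F" by (simp only: count_greater_zero_iff)
  qed (use mem in \<open>blast dest: in_diffD\<close>)
  then have "set_mset (?S - F) = K" by blast
  with K show "power_dominating V E (set_mset (?S - F))" by simp
qed

text \<open>If at most \<open>k\<close> elements lay in \<open>D\<close>, deleting all of them would
  leave no vertex whose closed neighbourhood meets the fort.\<close>

lemma robust_near_fort:
  assumes G: "simple_graph V E" and S: "robust_power_dominating V E k S"
    and F: "fort V E F" and D: "\<And>v. v \<in> V \<Longrightarrow> closed_nbhd E v \<inter> F \<noteq> {} \<Longrightarrow> v \<in> D"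
  shows "k + 1 \<le> size (filter_mset (\<lambda>x. x \<in> D) S)"
proof (rule ccontr)
  let ?M = "filter_mset (\<lambda>x. x \<in> D) S" and ?M' = "filter_mset (\<lambda>x. x \<notin> D) S"
  assume "\<not> ?thesis"
  then have le: "size ?M \<le> k" by simp
  have S_eq: "S = ?M + ?M'" by (rule multiset_partition)
  obtain xs where xs: "mset xs = ?M'" using ex_mset by blast
  \<comment> \<open>Robustness speaks of exactly \<open>k\<close> deletions, so the elements in
    \<open>D\<close> are padded with \<open>?n\<close> others.\<close>
  let ?n = "k - size ?M"
  define X where "X = ?M + mset (take ?n xs)"
  have S_X: "S = X + mset (drop ?n xs)"
    by (subst S_eq) (simp add: X_def flip: xs mset_append)
  have "size S = size ?M + length xs"
    by (subst S_eq) (simp flip: xs)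
  moreover have "k \<le> size S" using S by (simp add: robust_power_dominating_def)
  ultimately have "size X = k" using le by (simp add: X_def)
  moreover have "X \<subseteq># S" by (subst S_X) simp
  moreover have "S - X = mset (drop ?n xs)" by (subst S_X) simp
  ultimately have pd: "power_dominating V E (set (drop ?n xs))"
    using S by (metis robust_power_dominating_def set_mset_mset)
  have "set xs = set_mset ?M'" by (simp flip: xs)
  then have "set (drop ?n xs) \<inter> D = {}"
    using set_drop_subset[of ?n xs] by auto
  moreover obtain v where "v \<in> set (drop ?n xs)" "closed_nbhd E v \<inter> F \<noteq> {}" "v \<in> V"
    using pd power_dominating_iff_meets_forts[OF G] F by (metis subsetD)
  ultimately show False using D by (metis disjoint_iff)
qed

section \<open>Rooting a tree\<close>

text \<open>A walk becomes a path by cutting it back whenever it returns to a visited vertex. The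
  bound on \<open>set vs\<close> later confines a path along induced edges to the inducing
  set.\<close>

lemma edge_path:
  assumes "(a, b) \<in> {(x, y). {x, y} \<in> E}\<^sup>*"
  shows "\<exists>vs. vs \<noteq> [] \<and> hd vs = a \<and> last vs = b \<and> distinct vs \<and>
    successively (\<lambda>x y. {x, y} \<in> E) vs \<and> set vs \<subseteq> insert a (\<Union>E)"
  using assms
proof (induction rule: rtrancl_induct)
  case base
  show ?case by (rule exI[of _ "[a]"]) simp
next
  case (step b c)
  then obtain vs where vs: "vs \<noteq> []" "hd vs = a" "last vs = b" "distinct vs"
    "successively (\<lambda>x y. {x, y} \<in> E) vs" "set vs \<subseteq> insert a (\<Union>E)" by blast
  show ?case
  proof (cases "c \<in> set vs")
    case True
    then obtain us ws where split: "vs = us @ c # ws" by (auto simp: in_set_conv_decomp)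
    show ?thesis
      by (rule exI[of _ "us @ [c]"])
        (use vs split in \<open>auto simp: hd_append successively_append_iff split: if_splits\<close>)
  next
    case False
    show ?thesis
      by (rule exI[of _ "vs @ [c]"])
        (use vs step.hyps False in \<open>auto simp: successively_append_iff\<close>)
  qed
qed

text \<open>The parent map encodes the tree, so that arguments become inductions on
  \<open>d\<close>. The rank need not be the depth, and \<open>p r\<close> is arbitrary.\<close>

locale rooted_tree =
  fixes V :: "'a set" and E :: "'a set set" and r :: 'a and p :: "'a \<Rightarrow> 'a" and d :: "'a \<Rightarrow> nat"
  assumes finite_V: "finite V"
    and root: "r \<in> V"
    and parent: "x \<in> V \<Longrightarrow> x \<noteq> r \<Longrightarrow> p x \<in> V"
    and rank: "x \<in> V \<Longrightarrow> x \<noteq> r \<Longrightarrow> d (p x) < d x"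
    and edges: "E = {{x, p x} | x. x \<in> V - {r}}"
begin

lemma parent_neq: "x \<in> V \<Longrightarrow> x \<noteq> r \<Longrightarrow> p x \<noteq> x"
  using rank by force

lemma edge_iff: "{x, y} \<in> E \<longleftrightarrow> (x \<in> V - {r} \<and> y = p x) \<or> (y \<in> V - {r} \<and> x = p y)"
  by (auto simp: edges doubleton_eq_iff)

lemma edge_in_V: "{x, y} \<in> E \<Longrightarrow> x \<in> V \<and> y \<in> V"
  using parent by (auto simp: edge_iff)

lemma simple_graph: "simple_graph V E"
  unfolding simple_graph_def
proof (intro conjI ballI)
  fix e assume "e \<in> E"
  then obtain x where x: "e = {x, p x}" "x \<in> V" "x \<noteq> r" by (auto simp: edges)
  then show "e \<subseteq> V" "card e = 2" using parent parent_neq[of x] by auto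
qed (use finite_V root in auto)

lemma sym_edges: "sym {(x, y). {x, y} \<in> E}"
  by (auto simp: sym_def insert_commute)

lemma reaches_root: "x \<in> V \<Longrightarrow> (x, r) \<in> {(x, y). {x, y} \<in> E}\<^sup>*"
proof (induction "d x" arbitrary: x rule: less_induct)
  case less
  show ?case
  proof (cases "x = r")
    case False
    with less have "(p x, r) \<in> {(x, y). {x, y} \<in> E}\<^sup>*" "{x, p x} \<in> E"
      using rank parent by (auto simp: edge_iff)
    then show ?thesis by (metis (mono_tags, lifting) case_prodI converse_rtrancl_into_rtrancl mem_Collect_eq)
  qed simp
qed

lemma connected: "connected_graph V E"
  unfolding connected_graph_def
  using reaches_root sym_edges by (meson rtrancl_trans sym_rtrancl symD)

end

text \<open>Take a maximal set \<open>W\<close> inducing a rooted tree. A vertex outside but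
  adjacent to \<open>W\<close> has a single neighbour in it, since two would be joined by a path in
  \<open>W\<close> and close a cycle. So it could be added as a leaf.\<close>

lemma rooted_tree_exists:
  assumes "is_tree V E"
  obtains r p d where "rooted_tree V E r p d"
proof -
  have G: "simple_graph V E" and conn: "connected_graph V E" and acyc: "\<nexists>vs. is_cycle E vs"
    using assms by (auto simp: is_tree_def)
  have finV: "finite V" and card2: "\<And>e. e \<in> E \<Longrightarrow> card e = 2" and EV: "\<And>e. e \<in> E \<Longrightarrow> e \<subseteq> V"
    using G by (auto simp: simple_graph_def)
  define Q where "Q W \<longleftrightarrow> W \<subseteq> V \<and> (\<exists>r p d. rooted_tree W (induced_edges E W) r p (d :: 'a \<Rightarrow> nat))" for W
  obtain v where v: "v \<in> V" using G by (auto simp: simple_graph_def)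
  have "induced_edges E {v} = {}"
    using card2 by (fastforce simp: induced_edges_def subset_singleton_iff)
  then have "rooted_tree {v} (induced_edges E {v}) v id (\<lambda>_. 0)"
    by unfold_locales auto
  with v have "Q {v}" unfolding Q_def by blast
  moreover have "finite {W. Q W}"
    by (rule finite_subset[OF _ finite_Pow_iff[THEN iffD2, OF finV]]) (auto simp: Q_def)
  ultimately obtain W where W: "Q W" and max: "\<And>W'. Q W' \<Longrightarrow> W \<subseteq> W' \<Longrightarrow> W' = W"
    using finite_has_maximal[of "{W. Q W}"] by (metis (no_types, lifting) empty_iff mem_Collect_eq)
  then obtain r p d where "rooted_tree W (induced_edges E W) r p (d :: 'a \<Rightarrow> nat)" and WV: "W \<subseteq> V"
    by (auto simp: Q_def)
  then interpret W: rooted_tree W "induced_edges E W" r p d by blast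
  have "W = V"
  proof (rule ccontr)
    assume "W \<noteq> V"
    then obtain u where u: "u \<in> V" "u \<notin> W" using WV by blast
    have "(r, u) \<in> {(x, y). {x, y} \<in> E}\<^sup>*"
      using conn W.root WV u by (auto simp: connected_graph_def)
    then have "u \<in> W \<or> (\<exists>a w. a \<in> W \<and> w \<notin> W \<and> {a, w} \<in> E)"
      by (induction rule: rtrancl_induct) (use W.root in auto)
    then obtain a w where aw: "a \<in> W" "w \<notin> W" "{a, w} \<in> E" using u by blast
    have unique: "b = a" if b: "b \<in> W" "{b, w} \<in> E" for b
    proof (rule ccontr)
      assume "b \<noteq> a"
      have "(a, b) \<in> {(x, y). {x, y} \<in> induced_edges E W}\<^sup>*"
        using W.connected aw b by (auto simp: connected_graph_def)
      from edge_path[OF this] obtain vs where vs: "vs \<noteq> []" "hd vs = a" "last vs = b"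
        "distinct vs" "successively (\<lambda>x y. {x, y} \<in> induced_edges E W) vs"
        "set vs \<subseteq> insert a (\<Union>(induced_edges E W))" by blast
      have sub: "set vs \<subseteq> W" using vs(6) aw by (auto simp: induced_edges_def)
      have len: "length vs \<ge> 2"
        using vs \<open>b \<noteq> a\<close> by (cases vs; cases "tl vs") auto
      have "is_cycle E (vs @ [w])"
        unfolding is_cycle_def
      proof (intro conjI allI impI)
        fix i assume "i < length (vs @ [w])"
        then consider "Suc i < length vs" | "Suc i = length vs" | "i = length vs" by fastforce
        then show "{(vs @ [w]) ! i, (vs @ [w]) ! (Suc i mod length (vs @ [w]))} \<in> E"
        proof cases
          case 1
          with vs(5) have "{vs ! i, vs ! Suc i} \<in> E"
            by (auto simp: successively_conv_nth induced_edges_def)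
          with 1 show ?thesis by (simp add: nth_append)
        next
          case 2
          then have "vs ! i = b" using vs(1,3) by (metis diff_Suc_1 last_conv_nth)
          with 2 b show ?thesis by (simp add: nth_append)
        next
          case 3
          have "vs ! 0 = a" using vs by (simp add: hd_conv_nth)
          with 3 vs(1) aw show ?thesis by (simp add: nth_append insert_commute)
        qed
      qed (use len vs sub aw in auto)
      with acyc show False by blast
    qed
    have "{x, p x} \<in> E" if "x \<in> W" "x \<noteq> r" for x
      using that W.edge_iff[of x "p x"] by (auto simp: induced_edges_def)
    moreover have "\<exists>x. e = {x, (p(w := a)) x} \<and> x \<in> insert w W - {r}"
      if e: "e \<in> E" "e \<subseteq> insert w W" for e
    proof (cases "w \<in> e")
      case True
      with card2[OF e(1)] obtain b where b: "e = {b, w}" "b \<noteq> w"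
        by (metis card_2_iff' insertE insert_absorb2 card_2_iff insert_commute singletonD)
      with e have "b = a" using unique by auto
      with b W.root aw show ?thesis by (intro exI[of _ w]) (auto simp: insert_commute)
    next
      case False
      with e have "e \<in> induced_edges E W" by (auto simp: induced_edges_def)
      with W.edges obtain x where "e = {x, p x}" "x \<in> W" "x \<noteq> r" by auto
      with aw show ?thesis by (intro exI[of _ x]) auto
    qed
    moreover have "{x, (p(w := a)) x} \<in> E \<and> {x, (p(w := a)) x} \<subseteq> insert w W"
      if "x \<in> insert w W - {r}" for x
      using that aw W.parent calculation(1)[of x] by (cases "x = w") (auto simp: insert_commute)
    ultimately have "e \<in> induced_edges E (insert w W) \<longleftrightarrow>
        (\<exists>x. e = {x, (p(w := a)) x} \<and> x \<in> insert w W - {r})" for e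
      unfolding induced_edges_def by blast
    then have "induced_edges E (insert w W) = {{x, (p(w := a)) x} | x. x \<in> insert w W - {r}}"
      by blast
    then have "rooted_tree (insert w W) (induced_edges E (insert w W)) r (p(w := a)) (d(w := Suc (d a)))"
      using W.finite_V W.root W.parent W.rank aw by unfold_locales auto
    moreover have "w \<in> V" using aw EV by blast
    ultimately have "Q (insert w W)" using WV unfolding Q_def by blast
    with max aw show False by blast
  qed
  moreover have "induced_edges E V = E" using EV by (auto simp: induced_edges_def)
  ultimately have "rooted_tree V E r p d" using W.rooted_tree_axioms by simp
  with that show thesis .
qed

section \<open>From spider covers to power dominating sets\<close>

text \<open>Walk from \<open>c\<close> inside \<open>U\<close> and off \<open>F\<close> up to a
  vertex \<open>w\<close> next to the fort. Its neighbours in \<open>U\<close> are its predecessor,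
  outside \<open>F\<close>, and one fort vertex, so the second fort neighbour that the fort
  condition demands lies outside \<open>U\<close>.\<close>

lemma fort_exits_spider:
  assumes F: "fort V E F" and conn: "connected_graph U (induced_edges E U)"
    and c: "c \<in> U" "closed_nbhd E c \<inter> F = {}"
    and deg: "\<And>v. v \<in> U \<Longrightarrow> v \<noteq> c \<Longrightarrow>
      finite (nbhd E v) \<and> vertex_degree (induced_edges E U) v \<le> 2"
    and meets: "U \<inter> F \<noteq> {}"
  obtains w x where "w \<in> U - F" "x \<in> F - U" "{w, x} \<in> E"
proof -
  let ?I = "induced_edges E U"
  define R where "R = {w. (c, w) \<in> {(x, y). {x, y} \<in> ?I \<and> x \<notin> F \<and> y \<notin> F}\<^sup>*}"
  have cF: "c \<notin> F" and cn: "nbhd E c \<inter> F = {}" using c(2) by (auto simp: closed_nbhd_def)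
  have RF: "w \<notin> F" if "w \<in> R" for w
    using that cF unfolding R_def by (auto elim: rtranclE)
  obtain y where y: "y \<in> U" "y \<in> F" using meets by blast
  have "(c, y) \<in> {(x, y). {x, y} \<in> ?I}\<^sup>*"
    using conn c(1) y(1) by (auto simp: connected_graph_def)
  then have "y \<in> R \<or> (\<exists>w x. w \<in> R \<and> x \<notin> R \<and> {w, x} \<in> ?I)"
    by (induction rule: rtrancl_induct) (auto simp: R_def)
  then obtain w x where wx: "w \<in> R" "x \<notin> R" "{w, x} \<in> ?I" using y RF by blast
  have wU: "w \<in> U" and wE: "{w, x} \<in> E" using wx(3) by (auto simp: induced_edges_def)
  have xF: "x \<in> F"
  proof (rule ccontr)
    assume "x \<notin> F"
    with wx RF have "(w, x) \<in> {(x, y). {x, y} \<in> ?I \<and> x \<notin> F \<and> y \<notin> F}" by blast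
    with wx(1) have "x \<in> R" unfolding R_def by (metis (no_types, lifting) mem_Collect_eq rtrancl.rtrancl_into_rtrancl)
    with wx(2) show False ..
  qed
  \<comment> \<open>The center has no fort neighbour. Hence the degree bound applies to
    \<open>w\<close>, and \<open>w\<close> has a predecessor on the walk.\<close>
  have "w \<noteq> c" using cn wE xF by (auto simp: nbhd_def)
  with wx(1) obtain w' where w': "{w', w} \<in> ?I" "w' \<notin> F"
    unfolding R_def by (auto elim: rtranclE)
  let ?N = "nbhd ?I w"
  have "finite ?N" and "card ?N \<le> 2"
    using deg[OF wU \<open>w \<noteq> c\<close>] by (auto simp: vertex_degree_def nbhd_def induced_edges_def intro: finite_subset[rotated])
  moreover have "{w', x} \<subseteq> ?N" using wx(3) w'(1) by (auto simp: nbhd_def insert_commute)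
  moreover have "card {w', x} = 2" using xF w'(2) by (simp add: card_insert_if) blast
  ultimately have N: "?N = {w', x}" by (metis card_seteq)
  have "nbhd E w \<inter> F \<noteq> {x}" using F RF[OF wx(1)] by (auto simp: fort_def)
  with wE xF obtain z where z: "z \<in> nbhd E w" "z \<in> F" "z \<noteq> x" by (auto simp: nbhd_def)
  have "z \<notin> U"
  proof
    assume "z \<in> U"
    with z(1) wU have "z \<in> ?N" by (auto simp: nbhd_def induced_edges_def)
    with N z w'(2) show False by auto
  qed
  with z wU RF[OF wx(1)] that[of w z] show thesis by (auto simp: nbhd_def)
qed

lemma spider_center:
  assumes "is_spider U I"
  obtains c where "c \<in> U" "\<And>v. v \<in> U \<Longrightarrow> v \<noteq> c \<Longrightarrow> vertex_degree I v \<le> 2"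
proof -
  let ?B = "{v \<in> U. 3 \<le> vertex_degree I v}"
  have U: "finite U" "U \<noteq> {}" and B: "card ?B \<le> 1"
    using assms by (auto simp: is_spider_def is_tree_def simple_graph_def)
  have "\<exists>c\<in>U. ?B \<subseteq> {c}"
  proof (cases "?B = {}")
    case False
    then obtain c where "c \<in> ?B" by blast
    moreover have "v = c" if "v \<in> ?B" for v
      using card_le_Suc0_iff_eq[of ?B] U(1) B \<open>c \<in> ?B\<close> that by auto
    ultimately show ?thesis by blast
  qed (use U(2) in blast)
  then obtain c where c: "c \<in> U" "?B \<subseteq> {c}" by blast
  have "vertex_degree I v \<le> 2" if "v \<in> U" "v \<noteq> c" for v
  proof (rule ccontr)
    assume "\<not> ?thesis"
    with that(1) have "v \<in> ?B" by simp
    with c(2) that(2) show False by blast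
  qed
  with c(1) show thesis by (rule that)
qed

context rooted_tree
begin

definition descendants :: "'a \<Rightarrow> 'a set" where
  "descendants x = {y. (y, x) \<in> {(y, p y) | y. y \<in> V - {r}}\<^sup>*}"

lemma self_descendant: "x \<in> descendants x"
  by (simp add: descendants_def)

lemma child_descendant: "y \<in> V - {r} \<Longrightarrow> p y \<in> descendants x \<Longrightarrow> y \<in> descendants x"
  unfolding descendants_def by (auto intro: converse_rtrancl_into_rtrancl)

lemma parent_descendant: "y \<in> descendants x \<Longrightarrow> y \<noteq> x \<Longrightarrow> p y \<in> descendants x"
  unfolding descendants_def by (auto elim: converse_rtranclE)

lemma descendant_rank: "y \<in> descendants x \<Longrightarrow> y = x \<or> d x < d y"
  unfolding descendants_def mem_Collect_eq
  by (induction rule: converse_rtrancl_induct) (use rank in fastforce)+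

lemma edge_leaving_descendants:
  assumes "{y, z} \<in> E" "y \<in> descendants x" "z \<notin> descendants x"
  shows "y = x \<and> z = p x \<and> x \<noteq> r"
  using assms child_descendant parent_descendant by (auto simp: edge_iff)

text \<open>The top is a vertex of least rank. If the parent of another vertex \<open>x\<close> were
  missing, no walk in \<open>U\<close> could leave the subtree at \<open>x\<close>, and the top
  would have larger rank than \<open>x\<close>.\<close>

lemma connected_part_top:
  assumes U: "U \<noteq> {}" and conn: "connected_graph U (induced_edges E U)"
  obtains t where "t \<in> U" "\<And>x. x \<in> U \<Longrightarrow> d t \<le> d x" "\<And>x. x \<in> U \<Longrightarrow> x \<noteq> t \<Longrightarrow> p x \<in> U"
proof -
  obtain t where t: "t \<in> U" "\<And>x. x \<in> U \<Longrightarrow> d t \<le> d x"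
    using ex_has_least_nat[of "\<lambda>x. x \<in> U" _ d] U by blast
  have "p x \<in> U" if x: "x \<in> U" "x \<noteq> t" for x
  proof (rule ccontr)
    assume "p x \<notin> U"
    have "(x, t) \<in> {(x, y). {x, y} \<in> induced_edges E U}\<^sup>*"
      using conn x t by (auto simp: connected_graph_def)
    then have "t \<in> descendants x"
    proof (induction rule: rtrancl_induct)
      case (step y z)
      then have "{y, z} \<in> E" "z \<in> U" by (auto simp: induced_edges_def)
      with edge_leaving_descendants step.IH \<open>p x \<notin> U\<close> show ?case by blast
    qed (rule self_descendant)
    with descendant_rank x t show False by fastforce
  qed
  with t that show thesis by blast
qed

text \<open>\<open>K\<close> takes one center per part. A fort missed by all of them leaves each
  part it meets for another one. From a part whose top is in the fort it can only go down, to
  another top in the fort of larger rank, and this cannot continue forever.\<close>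

lemma spider_cover_dominating:
  assumes P: "spider_cover V E P"
  obtains K where "power_dominating V E K" "card K \<le> card P"
proof -
  have part: "\<And>x. x \<in> V \<Longrightarrow> \<exists>U\<in>P. x \<in> U" and PV: "\<And>U. U \<in> P \<Longrightarrow> U \<subseteq> V"
    and disj: "\<And>U U' x. U \<in> P \<Longrightarrow> U' \<in> P \<Longrightarrow> x \<in> U \<Longrightarrow> x \<in> U' \<Longrightarrow> U = U'"
    and ne: "\<And>U. U \<in> P \<Longrightarrow> U \<noteq> {}"
    using P by (auto simp: spider_cover_def partition_on_def disjoint_def)
  have spider: "\<And>U. U \<in> P \<Longrightarrow> is_spider U (induced_edges E U)"
    using P by (simp add: spider_cover_def)
  then have conn: "\<And>U. U \<in> P \<Longrightarrow> connected_graph U (induced_edges E U)"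
    by (simp add: is_spider_def is_tree_def)
  have finP: "finite P" using PV finite_V by (meson Pow_iff finite_Pow_iff finite_subset subsetI)
  have "\<forall>U\<in>P. \<exists>c\<in>U. \<forall>v\<in>U. v \<noteq> c \<longrightarrow> vertex_degree (induced_edges E U) v \<le> 2"
    using spider by (meson spider_center)
  then obtain c where c: "\<And>U. U \<in> P \<Longrightarrow> c U \<in> U"
    "\<And>U v. U \<in> P \<Longrightarrow> v \<in> U \<Longrightarrow> v \<noteq> c U \<Longrightarrow> vertex_degree (induced_edges E U) v \<le> 2"
    by metis
  have "\<forall>U\<in>P. \<exists>t\<in>U. (\<forall>x\<in>U. d t \<le> d x) \<and> (\<forall>x\<in>U. x \<noteq> t \<longrightarrow> p x \<in> U)"
    using ne conn by (meson connected_part_top)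
  then obtain t where t: "\<And>U. U \<in> P \<Longrightarrow> t U \<in> U" "\<And>U x. U \<in> P \<Longrightarrow> x \<in> U \<Longrightarrow> d (t U) \<le> d x"
    "\<And>U x. U \<in> P \<Longrightarrow> x \<in> U \<Longrightarrow> x \<noteq> t U \<Longrightarrow> p x \<in> U"
    by metis
  have "\<exists>v\<in>c ` P. closed_nbhd E v \<inter> F \<noteq> {}" if F: "fort V E F" for F
  proof (rule ccontr)
    assume "\<not> ?thesis"
    then have far: "closed_nbhd E (c U) \<inter> F = {}" if "U \<in> P" for U using that by blast
    have FV: "F \<subseteq> V" and "F \<noteq> {}" using F by (auto simp: fort_def)
    have fin: "finite (nbhd E v)" for v
      using finite_V edge_in_V by (auto simp: nbhd_def intro: finite_subset)
    have exit: "\<exists>w x. w \<in> U - F \<and> x \<in> F - U \<and> {w, x} \<in> E"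
      if U: "U \<in> P" "U \<inter> F \<noteq> {}" for U
    proof -
      obtain w x where "w \<in> U - F" "x \<in> F - U" "{w, x} \<in> E"
        by (rule fort_exits_spider[OF F conn[OF U(1)] c(1)[OF U(1)] far[OF U(1)] _ U(2)])
          (use c(2)[OF U(1)] fin in blast)
      then show ?thesis by blast
    qed
    have enters_top: "\<exists>U'\<in>P. t U' = x" if U: "U \<in> P" "p x \<in> U" and x: "x \<in> F - U" for U x
    proof -
      obtain U' where U': "U' \<in> P" "x \<in> U'" using part x FV by blast
      have "p x \<notin> U'" using disj[OF U(1) U'(1) U(2)] U'(2) x by blast
      with t(3)[OF U'] U'(1) show ?thesis by blast
    qed
    define Z where "Z = {x \<in> F. \<exists>U\<in>P. t U = x}"
    have ascend: "\<exists>x'\<in>Z. d x < d x'" if x: "x \<in> Z" for x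
    proof -
      from x obtain U where U: "U \<in> P" "t U = x" "x \<in> F" by (auto simp: Z_def)
      then obtain w x' where wx: "w \<in> U - F" "x' \<in> F - U" "{w, x'} \<in> E"
        using exit[of U] t(1) by blast
      \<comment> \<open>An edge going up out of \<open>U\<close> leaves at the top, which is in
        \<open>F\<close> whereas \<open>w\<close> is not.\<close>
      have "x' \<noteq> p w" using t(3)[OF U(1), of w] wx U by auto
      with wx(3) have x': "x' \<in> V - {r}" "w = p x'" by (auto simp: edge_iff)
      with enters_top[OF U(1)] wx have "x' \<in> Z" by (auto simp: Z_def)
      moreover have "d x < d x'" using t(2)[OF U(1), of w] rank[of x'] x' U wx by auto
      ultimately show ?thesis ..
    qed
    \<comment> \<open>To start the ascent, take a part met by the fort whose top has least rank. An
      exit upwards would reach a part with a top of smaller rank, so the exit goes down.\<close>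
    obtain U0 where U0: "U0 \<in> P" "U0 \<inter> F \<noteq> {}"
      and min: "\<And>U. U \<in> P \<Longrightarrow> U \<inter> F \<noteq> {} \<Longrightarrow> d (t U0) \<le> d (t U)"
    proof -
      obtain U where "U \<in> P \<and> U \<inter> F \<noteq> {}" using part FV \<open>F \<noteq> {}\<close> by blast
      from ex_has_least_nat[of "\<lambda>U. U \<in> P \<and> U \<inter> F \<noteq> {}", OF this, of "\<lambda>U. d (t U)"]
      show thesis using that by blast
    qed
    obtain w x where wx: "w \<in> U0 - F" "x \<in> F - U0" "{w, x} \<in> E" using exit[OF U0] by blast
    have "\<not> (w \<in> V - {r} \<and> x = p w)"
    proof
      assume up: "w \<in> V - {r} \<and> x = p w"
      then have "w = t U0" using t(3)[OF U0(1)] wx by blast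
      moreover obtain U where "U \<in> P" "x \<in> U" using part wx FV by blast
      ultimately show False using min[of U] t(2)[of U x] rank[of w] up wx by fastforce
    qed
    with wx(3) have "w = p x" by (auto simp: edge_iff)
    with enters_top[OF U0(1)] wx have "x \<in> Z" by (auto simp: Z_def)
    moreover have "finite Z" using FV finite_V by (auto simp: Z_def intro: finite_subset)
    ultimately have "Max (d ` Z) \<in> d ` Z" by (intro Max_in) auto
    then obtain z where z: "z \<in> Z" "d z = Max (d ` Z)" by auto
    with ascend obtain z' where "z' \<in> Z" "d z < d z'" by blast
    with z(2) \<open>finite Z\<close> show False by (metis Max_ge finite_imageI image_eqI not_le)
  qed
  moreover have "c ` P \<subseteq> V" using c PV by blast
  ultimately have "power_dominating V E (c ` P)"
    using power_dominating_iff_meets_forts[OF simple_graph] by blast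
  with finP that card_image_le show thesis by blast
qed

end

section \<open>Bottom-up labelling\<close>

text \<open>Serves functions whose recursion terminates only under local assumptions:
  \<open>H f x\<close> may read \<open>f\<close> only at \<open>R\<close>-predecessors of
  \<open>x\<close>.\<close>

lemma wf_recursion_exists:
  assumes "wf R" and "\<And>f g x. (\<And>y. (y, x) \<in> R \<Longrightarrow> f y = g y) \<Longrightarrow> H f x = H g x"
  shows "\<exists>f. \<forall>x. f x = H f x"
proof -
  have "adm_wf R H" using assms(2) unfolding adm_wf_def by blast
  from wfrec_fixpoint[OF assms(1) this] show ?thesis by metis
qed

text \<open>\<open>s x\<close> is the point where iterating \<open>g\<close> from \<open>x\<close>
  first leaves \<open>Q\<close>.\<close>

lemma owner_exists:
  assumes "\<And>x. Q x \<Longrightarrow> \<mu> (g x) < (\<mu> x :: nat)"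
  shows "\<exists>s. \<forall>x. s x = (if Q x then s (g x) else x)"
  by (rule wf_recursion_exists[of "measure \<mu>" "\<lambda>s x. if Q x then s (g x) else x"])
    (use assms in auto)

text \<open>
  The state of a vertex \<open>x\<close> after the part of the tree below \<open>x\<close> has been handled. \<open>Open\<close>:
  \<open>x\<close> is not observed from below. \<open>Done\<close>: \<open>x\<close> and all its children are observed, so \<open>x\<close> can force
  its parent. \<open>Half\<close>: \<open>x\<close> is observed but has one unobserved child, which \<open>x\<close> forces once its
  parent is observed. A vertex with two or more \<open>Open\<close> children is made a center.
\<close>

datatype status = Done | Half | Open

context rooted_tree
begin

definition open_children :: "('a \<Rightarrow> status) \<Rightarrow> 'a \<Rightarrow> 'a set" where
  "open_children f x = {c \<in> V - {r}. p c = x \<and> f c = Open}"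

definition has_done_child :: "('a \<Rightarrow> status) \<Rightarrow> 'a \<Rightarrow> bool" where
  "has_done_child f x \<longleftrightarrow> (\<exists>c\<in>V - {r}. p c = x \<and> f c = Done)"

definition settle :: "('a \<Rightarrow> status) \<Rightarrow> 'a \<Rightarrow> status" where
  "settle f x =
    (if 2 \<le> card (open_children f x) \<or> open_children f x = {} \<and> has_done_child f x then Done
     else if has_done_child f x then Half else Open)"

end

locale labelled_tree = rooted_tree +
  fixes st :: "'a \<Rightarrow> status"
  assumes status: "st x = settle st x"
begin

abbreviation opens :: "'a \<Rightarrow> 'a set" where
  "opens \<equiv> open_children st"

abbreviation supplied :: "'a \<Rightarrow> bool" where
  "supplied \<equiv> has_done_child st"

text \<open>An \<open>Open\<close> root has no parent to observe it and becomes a center. A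
  \<open>Half\<close> root is observed and can force its one \<open>Open\<close> child at
  once.\<close>

definition centers :: "'a set" where
  "centers = {x \<in> V. 2 \<le> card (opens x) \<or> x = r \<and> st r = Open}"

lemma finite_opens: "finite (opens x)"
  using finite_V by (auto simp: open_children_def)

lemma status_DoneD: "st x = Done \<Longrightarrow> 2 \<le> card (opens x) \<or> opens x = {} \<and> supplied x"
  and status_HalfD: "st x = Half \<Longrightarrow> \<not> 2 \<le> card (opens x) \<and> opens x \<noteq> {} \<and> supplied x"
  and status_OpenD: "st x = Open \<Longrightarrow> \<not> 2 \<le> card (opens x) \<and> \<not> supplied x"
  using status[of x] by (auto simp: settle_def split: if_splits)

section \<open>Forts with disjoint closed neighbourhoods\<close>

text \<open>The map \<open>s\<close> names the only center whose fort can be near a vertex; this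
  expresses disjointness of the closed neighbourhoods in a form ready for counting.\<close>

lemma packing_exists:
  "\<exists>s F. \<forall>v\<in>centers. fort V E (F v) \<and> (\<forall>z\<in>V. closed_nbhd E z \<inter> F v \<noteq> {} \<longrightarrow> s z = v)"
proof -
  \<comment> \<open>Forts consist of \<open>Open\<close> vertices; \<open>Half\<close> vertices join their \<open>Open\<close> child to an \<open>Open\<close>
    parent, so that neither of the two is the only fort neighbour.\<close>
  define linked where
    "linked x \<longleftrightarrow> x \<in> V - {r} \<and> (st x = Open \<or> st x = Half \<and> st (p x) = Open)" for x
  obtain s where s: "\<And>x. s x = (if linked x then s (p x) else x)"
    using owner_exists[of linked d p] rank by (auto simp: linked_def)
  define F where "F v = {y \<in> V. st y = Open \<and> s y = v}" for v
  \<comment> \<open>An \<open>Open\<close> neighbour with owner \<open>v\<close> is in the fort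
    itself, so only the other neighbours need a second fort neighbour.\<close>
  have near: "s z = v \<and> (st z \<noteq> Open \<longrightarrow> (\<exists>y'\<in>F v. y' \<noteq> y \<and> {z, y'} \<in> E))"
    if v: "v \<in> centers" and y: "y \<in> F v" and zy: "{z, y} \<in> E" for v y z
  proof -
    have yO: "y \<in> V" "st y = Open" "s y = v" using y by (auto simp: F_def)
    have zV: "z \<in> V" using zy edge_in_V by blast
    have open_child: "c \<in> V \<and> c \<noteq> r \<and> st c = Open \<and> p c = x \<and> s c = s x \<and> {x, c} \<in> E"
      if "c \<in> opens x" for c x
      using that s[of c] by (auto simp: open_children_def linked_def edge_iff)
    consider (up) "y \<in> V - {r}" "z = p y" | (down) "z \<in> V - {r}" "y = p z"
      using zy by (auto simp: edge_iff)
    then show ?thesis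
    proof cases
      case up
      then have yz: "y \<in> opens z" using yO by (simp add: open_children_def)
      with open_child yO have sz: "s z = v" by force
      have "\<exists>y'\<in>F v. y' \<noteq> y \<and> {z, y'} \<in> E" if "st z \<noteq> Open"
      proof (cases "st z")
        case Done
        \<comment> \<open>A \<open>Done\<close> vertex with an \<open>Open\<close> child has at
          least two.\<close>
        with status_DoneD[of z] yz have "2 \<le> card (opens z)" by auto
        then have "\<not> opens z \<subseteq> {y}"
          using card_mono[of "{y}" "opens z"] by auto
        then obtain y' where "y' \<in> opens z" "y' \<noteq> y" by blast
        with open_child[of y' z] sz show ?thesis by (auto simp: F_def)
      next
        case Half
        \<comment> \<open>An unlinked \<open>z\<close> would be its own owner, hence the center
          \<open>v\<close>, but a \<open>Half\<close> vertex is never a center.\<close>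
        have "linked z"
        proof (rule ccontr)
          assume "\<not> linked z"
          with s[of z] sz have "z = v" by simp
          with v Half status_HalfD[of z] show False by (auto simp: centers_def)
        qed
        with Half have z: "z \<in> V" "z \<noteq> r" "st (p z) = Open" "s (p z) = v"
          using s[of z] sz by (auto simp: linked_def)
        then have "p z \<in> F v" "{z, p z} \<in> E"
          using parent by (auto simp: F_def edge_iff)
        moreover have "p z \<noteq> y" using rank[of z] rank[of y] z up by auto
        ultimately show ?thesis by blast
      qed (use that in simp)
      with sz show ?thesis by blast
    next
      case down
      \<comment> \<open>An \<open>Open\<close> vertex has no \<open>Done\<close> child, so
        \<open>z\<close> is \<open>Open\<close>, or \<open>Half\<close> below an \<open>Open\<close>
        parent, and linked either way.\<close>
      have "st z \<noteq> Done" using status_OpenD[OF yO(2)] down by (auto simp: has_done_child_def)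
      then have "linked z" using down yO by (cases "st z") (auto simp: linked_def)
      then have sz: "s z = v" using s[of z] down yO by simp
      have "\<exists>y'\<in>F v. y' \<noteq> y \<and> {z, y'} \<in> E" if "st z \<noteq> Open"
      proof -
        have "st z = Half" using that \<open>st z \<noteq> Done\<close> by (cases "st z") auto
        then obtain c where "c \<in> opens z" using status_HalfD by blast
        with open_child[of c z] sz have c: "c \<in> F v" "{z, c} \<in> E" "c \<in> V" "c \<noteq> r" "p c = z"
          by (auto simp: F_def)
        moreover have "c \<noteq> y" using rank[of c] rank[of z] c down by auto
        ultimately show ?thesis by blast
      qed
      with sz show ?thesis by blast
    qed
  qed
  have "fort V E (F v) \<and> (\<forall>z\<in>V. closed_nbhd E z \<inter> F v \<noteq> {} \<longrightarrow> s z = v)"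
    if v: "v \<in> centers" for v
  proof (intro conjI ballI impI)
    \<comment> \<open>A center is \<open>Done\<close> or the root, so its chain ends at
      once.\<close>
    have "\<not> linked v" "v \<in> V"
      using v status[of v] by (auto simp: centers_def linked_def settle_def)
    then have sv: "s v = v" using s[of v] by simp
    have "F v \<noteq> {}"
    proof (cases "2 \<le> card (opens v)")
      case True
      then obtain c where "c \<in> opens v" by fastforce
      with s[of c] sv have "c \<in> F v" by (auto simp: open_children_def linked_def F_def)
      then show ?thesis by blast
    next
      case False
      with v sv have "v \<in> F v" by (auto simp: centers_def F_def)
      then show ?thesis by blast
    qed
    moreover have "nbhd E z \<inter> F v \<noteq> {y}" if "z \<notin> F v" for z y
    proof
      assume eq: "nbhd E z \<inter> F v = {y}"
      then have y: "y \<in> F v" "{z, y} \<in> E" by (auto simp: nbhd_def)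
      with near[OF v y] that edge_in_V[of z y] have "st z \<noteq> Open" by (auto simp: F_def)
      with near[OF v y] eq show False by (auto simp: nbhd_def)
    qed
    ultimately show "fort V E (F v)" by (auto simp: fort_def F_def)
    fix z assume "z \<in> V" "closed_nbhd E z \<inter> F v \<noteq> {}"
    then consider "z \<in> F v" | y where "y \<in> F v" "{z, y} \<in> E"
      by (auto simp: closed_nbhd_def nbhd_def)
    then show "s z = v" using near[OF v] by cases (auto simp: F_def)
  qed
  then show ?thesis by blast
qed

section \<open>A spider cover with one part per center\<close>

text \<open>A part collects the vertices whose \<open>g\<close>-chains end at the same center. Every
  edge inside it is a \<open>g\<close>-step, and a noncentral vertex has one successor and at most
  one noncentral predecessor, so the part consists of legs at the center.\<close>

lemma spider_cover_exists:
  assumes acyc: "\<nexists>vs. is_cycle E vs"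
  shows "\<exists>P. spider_cover V E P \<and> card P = card centers"
proof -
  \<comment> \<open>\<open>g x\<close> is the vertex that observes \<open>x\<close>: a spider leg climbs through \<open>Done\<close> vertices and
    descends through \<open>Open\<close> ones, with at most one \<open>Half\<close> vertex at the turn. \<open>\<mu>\<close> decreases
    along \<open>g\<close>.\<close>
  define g where
    "g x = (if st x = Open then p x else (SOME c. c \<in> V - {r} \<and> p c = x \<and> st c = Done))" for x
  have g_Open: "x \<noteq> r \<and> g x = p x" if "x \<in> V - centers" "st x = Open" for x
    using that by (auto simp: g_def centers_def)
  have g_child: "g x \<in> V - {r} \<and> p (g x) = x \<and> st (g x) = Done"
    if "x \<in> V - centers" "st x \<noteq> Open" for x
  proof -
    have "supplied x"
      using that status_DoneD[of x] status_HalfD[of x] by (cases "st x") (auto simp: centers_def)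
    then have "\<exists>c. c \<in> V - {r} \<and> p c = x \<and> st c = Done" by (auto simp: has_done_child_def)
    from someI_ex[OF this] that show ?thesis by (simp add: g_def)
  qed
  have gV: "g x \<in> V" and g_edge: "{x, g x} \<in> E" if "x \<in> V - centers" for x
    using g_Open[OF that] g_child[OF that] that parent[of x] edge_iff[of x "g x"]
    by (cases "st x = Open"; auto)+
  obtain M where M: "\<And>x. x \<in> V \<Longrightarrow> d x \<le> M"
    using finite_V by (metis Max_ge finite_imageI image_eqI)
  \<comment> \<open>The offsets place \<open>Done\<close> below \<open>Half\<close> below
    \<open>Open\<close>. Climbing lowers the value among \<open>Open\<close> vertices, descending
    among \<open>Done\<close> ones, where \<open>M\<close> keeps the subtraction exact.\<close>
  define \<mu> where "\<mu> x = (case st x of Done \<Rightarrow> M - d x | Half \<Rightarrow> M + 1 | Open \<Rightarrow> M + 2 + d x)" for x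
  have \<mu>: "\<mu> (g x) < \<mu> x" if x: "x \<in> V - centers" for x
  proof (cases "st x = Open")
    case True
    with g_Open[OF x True] x rank[of x] show ?thesis
      by (cases "st (p x)") (auto simp: \<mu>_def)
  next
    case False
    with g_child[OF x False] rank[of "g x"] M[of "g x"] show ?thesis
      by (cases "st x") (auto simp: \<mu>_def)
  qed
  obtain s where s: "\<And>x. s x = (if x \<in> V - centers then s (g x) else x)"
    using owner_exists[of "\<lambda>x. x \<in> V - centers" \<mu> g] \<mu> by blast
  have follow: "R x" if "x \<in> V" and base: "\<And>x. x \<in> centers \<Longrightarrow> R x"
    and step: "\<And>x. x \<in> V - centers \<Longrightarrow> R (g x) \<Longrightarrow> R x" for R x
    using that(1)
  proof (induction "\<mu> x" arbitrary: x rule: less_induct)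
    case less
    with base step[of x] \<mu>[of x] gV[of x] show ?case by blast
  qed
  have s_center: "s x = x" if "x \<in> centers" for x using s[of x] that by simp
  have s_step: "s x = s (g x)" if "x \<in> V - centers" for x using s[of x] that by simp
  have s_centers: "s x \<in> centers" if "x \<in> V" for x
    using that by (rule follow) (simp_all add: s_center s_step)
  define U where "U c = {x \<in> V. s x = c}" for c
  have CV: "centers \<subseteq> V" by (auto simp: centers_def)

  have unique: "z = z'" if "z \<in> V - centers" "z' \<in> V - centers" "g z = x" "g z' = x"
    "x \<in> V - centers" for x z z'
  proof -
    \<comment> \<open>For a noncentral \<open>x\<close> the two kinds of predecessor exclude each
      other: if \<open>Done\<close>, it has no \<open>Open\<close> child; otherwise it has at most
      one.\<close>
    have pre: "y \<in> opens x \<or> y = p x \<and> st x = Done" if "y \<in> V - centers" "g y = x" for y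
      using g_Open[of y] g_child[of y] that by (cases "st y = Open") (auto simp: open_children_def)
    have small: "\<not> 2 \<le> card (opens x)" using that(5) by (auto simp: centers_def)
    show ?thesis
    proof (cases "st x = Done")
      case True
      then have "opens x = {}" using status_DoneD small by blast
      with pre that show ?thesis by blast
    next
      case False
      then have "z \<in> opens x" "z' \<in> opens x" using pre that by blast+
      with small card_le_Suc0_iff_eq[OF finite_opens, of x] show ?thesis by auto
    qed
  qed
  have g_edges_up: "x \<notin> centers \<and> g x = p x \<or> p x \<notin> centers \<and> g (p x) = x"
    if x: "x \<in> V" "x \<noteq> r" and eq: "s x = s (p x)" for x
  proof (rule ccontr)
    assume no: "\<not> ?thesis"
    \<comment> \<open>If \<open>g\<close> does not use the edge between \<open>x\<close> and
      \<open>p x\<close>, no chain crosses it. Each vertex is then on the same side as its center,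
      and a shared center would put \<open>p x\<close> below \<open>x\<close>.\<close>
    have "z \<in> descendants x \<longleftrightarrow> s z \<in> descendants x" if "z \<in> V" for z
      using that
    proof (rule follow)
      fix y assume y: "y \<in> V - centers" and IH: "g y \<in> descendants x \<longleftrightarrow> s (g y) \<in> descendants x"
      have "{y, g y} \<in> E" "{g y, y} \<in> E" using g_edge[OF y] by (simp_all add: insert_commute)
      then have "y \<in> descendants x \<longleftrightarrow> g y \<in> descendants x"
        using no y by (metis DiffD2 edge_leaving_descendants)
      with IH s_step[OF y] show "y \<in> descendants x \<longleftrightarrow> s y \<in> descendants x" by simp
    qed (simp add: s_center)
    with eq x parent self_descendant have "p x \<in> descendants x" by metis
    with descendant_rank rank[OF x] parent_neq[OF x] show False by force
  qed
  have g_edges: "x \<notin> centers \<and> g x = y \<or> y \<notin> centers \<and> g y = x"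
    if "{x, y} \<in> E" "s x = s y" for x y
    using that g_edges_up[of x] g_edges_up[of y] by (auto simp: edge_iff)

  have spider: "is_spider (U c) (induced_edges E (U c))" if c: "c \<in> centers" for c
  proof -
    let ?I = "induced_edges E (U c)"
    have cU: "c \<in> U c" using c CV s_center by (auto simp: U_def)
    have "simple_graph (U c) ?I"
      using simple_graph cU finite_V by (auto simp: simple_graph_def induced_edges_def U_def)
    moreover have "connected_graph (U c) ?I"
    proof -
      have to_center: "s x = c \<longrightarrow> (x, c) \<in> {(x, y). {x, y} \<in> ?I}\<^sup>*" if "x \<in> V" for x
        using that
      proof (rule follow)
        fix x assume x: "x \<in> V - centers" and IH: "s (g x) = c \<longrightarrow> (g x, c) \<in> {(x, y). {x, y} \<in> ?I}\<^sup>*"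
        show "s x = c \<longrightarrow> (x, c) \<in> {(x, y). {x, y} \<in> ?I}\<^sup>*"
        proof
          assume sx: "s x = c"
          then have "(x, g x) \<in> {(x, y). {x, y} \<in> ?I}"
            using x gV[OF x] g_edge[OF x] s_step[OF x] by (auto simp: induced_edges_def U_def)
          moreover have "(g x, c) \<in> {(x, y). {x, y} \<in> ?I}\<^sup>*" using IH s_step[OF x] sx by simp
          ultimately show "(x, c) \<in> {(x, y). {x, y} \<in> ?I}\<^sup>*"
            by (rule converse_rtrancl_into_rtrancl)
        qed
      qed (simp add: s_center)
      have "sym {(x, y). {x, y} \<in> ?I}" by (auto simp: sym_def insert_commute)
      then have sym: "sym ({(x, y). {x, y} \<in> ?I}\<^sup>*)" by (rule sym_rtrancl)
      show ?thesis
        unfolding connected_graph_def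
      proof (intro ballI)
        fix u v assume "u \<in> U c" "v \<in> U c"
        then have "(u, c) \<in> {(x, y). {x, y} \<in> ?I}\<^sup>*" "(v, c) \<in> {(x, y). {x, y} \<in> ?I}\<^sup>*"
          using to_center by (simp_all add: U_def)
        from rtrancl_trans[OF this(1) symD[OF sym this(2)]]
        show "(u, v) \<in> {(x, y). {x, y} \<in> ?I}\<^sup>*" .
      qed
    qed
    moreover have "is_cycle E vs" if "is_cycle ?I vs" for vs
      using that by (simp add: is_cycle_def induced_edges_def)
    then have "\<nexists>vs. is_cycle ?I vs" using acyc by blast
    moreover have "card {v \<in> U c. 3 \<le> vertex_degree ?I v} \<le> 1"
    proof -
      have "vertex_degree ?I x \<le> 2" if x: "x \<in> U c" "x \<noteq> c" for x
      proof -
        have xC: "x \<in> V - centers" using x s_center by (auto simp: U_def)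
        \<comment> \<open>Inside the part, \<open>x\<close> is adjacent only to \<open>g x\<close>
          and to members of \<open>?Z\<close>, which has at most one element.\<close>
        let ?Z = "{z \<in> V - centers. g z = x}"
        have finZ: "finite ?Z" using finite_V by simp
        have "card ?Z \<le> 1"
          using card_le_Suc0_iff_eq[OF finZ] unique[OF _ _ _ _ xC] by auto
        then have "card (insert (g x) ?Z) \<le> 2" using finZ by (simp add: card_insert_if)
        moreover have "nbhd ?I x \<subseteq> insert (g x) ?Z"
        proof
          fix z assume "z \<in> nbhd ?I x"
          then have "{x, z} \<in> E" "z \<in> V" "s x = s z"
            by (auto simp: nbhd_def induced_edges_def U_def)
          with g_edges[of x z] show "z \<in> insert (g x) ?Z" by auto
        qed
        ultimately show ?thesis
          unfolding vertex_degree_def using finZ by (meson card_mono finite.insertI le_trans)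
      qed
      then have "{v \<in> U c. 3 \<le> vertex_degree ?I v} \<subseteq> {c}" by fastforce
      then show ?thesis using card_mono[of "{c}"] by fastforce
    qed
    ultimately show ?thesis by (simp add: is_spider_def is_tree_def)
  qed
  have member: "c \<in> U c" if "c \<in> centers" for c
    using that CV s_center by (auto simp: U_def)
  have "partition_on V (U ` centers)"
    using s_centers member by (intro partition_onI) (auto simp: U_def disjnt_def)
  moreover have "inj_on U centers"
  proof (rule inj_onI)
    fix x y assume "x \<in> centers" "y \<in> centers" "U x = U y"
    with member[of x] have "x \<in> U y" by simp
    with s_center[OF \<open>x \<in> centers\<close>] show "x = y" by (simp add: U_def)
  qed
  ultimately show ?thesis
    using spider by (intro exI[of _ "U ` centers"]) (auto simp: spider_cover_def card_image)
qed

end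

section \<open>Existence of the labelling and final count\<close>

text \<open>\<open>settle\<close> reads only the labels of children, and the child relation is
  well-founded because \<open>d\<close> is bounded on the finite set \<open>V\<close>.\<close>

lemma (in rooted_tree) labelling_exists: "\<exists>st. labelled_tree V E r p d st"
proof -
  obtain M where M: "\<And>x. x \<in> V \<Longrightarrow> d x \<le> M"
    using finite_V by (metis Max_ge finite_imageI image_eqI)
  have *: "d c \<le> M \<and> d (p c) < d c" if "c \<in> V - {r}" for c
    using that M rank by blast
  have "\<exists>st. \<forall>x. st x = settle st x"
  proof (rule wf_recursion_exists[of "{(c, x). c \<in> V - {r} \<and> p c = x}"])
    have "{(c, x). c \<in> V - {r} \<and> p c = x} \<subseteq> measure (\<lambda>x. M - d x)"
      using * by fastforce
    then show "wf {(c, x). c \<in> V - {r} \<and> p c = x}" by (rule wf_subset[OF wf_measure])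
  next
    fix f g :: "'a \<Rightarrow> status" and x
    assume fg: "\<And>y. (y, x) \<in> {(c, x). c \<in> V - {r} \<and> p c = x} \<Longrightarrow> f y = g y"
    have "open_children f x = open_children g x" "has_done_child f x = has_done_child g x"
      using fg by (auto simp: open_children_def has_done_child_def)
    then show "settle f x = settle g x" by (simp only: settle_def)
  qed
  then show ?thesis
    using rooted_tree_axioms by (auto simp: labelled_tree_def labelled_tree_axioms_def)
qed

text \<open>Distinct fibres of \<open>f\<close> share no element, so each occurrence in
  \<open>S\<close> is counted at most once.\<close>

lemma sum_size_fibres_le:
  assumes "finite C"
  shows "(\<Sum>c\<in>C. size (filter_mset (\<lambda>x. f x = c) S)) \<le> size S"
proof (induction S)
  case (add x S)
  have "(\<Sum>c\<in>C. size (filter_mset (\<lambda>x. f x = c) (add_mset x S))) =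
    (\<Sum>c\<in>C. size (filter_mset (\<lambda>x. f x = c) S) + (if f x = c then 1 else 0))"
    by (rule sum.cong) auto
  also have "\<dots> \<le> size S + 1"
    using add.IH assms by (simp add: sum.distrib)
  finally show ?case by simp
qed simp

theorem theorem5p2:
  fixes V :: "'a set" and E :: "'a set set" and k :: nat
  assumes "is_tree V E"
  shows "robust_power_domination_number V E k = (k + 1) * spider_number V E"
proof -
  obtain r p d where "rooted_tree V E r p d" using rooted_tree_exists[OF assms] .
  from rooted_tree.labelling_exists[OF this] obtain st where "labelled_tree V E r p d st" ..
  then interpret labelled_tree V E r p d st .
  have finC: "finite centers" using finite_V by (simp add: centers_def)

  obtain Q where Q: "spider_cover V E Q" "card Q = card centers"
    using spider_cover_exists assms by (auto simp: is_tree_def)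
  then have sp_le: "spider_number V E \<le> card centers"
    unfolding spider_number_def by (intro Least_le) blast
  have "\<exists>P. spider_cover V E P \<and> card P = spider_number V E"
    unfolding spider_number_def by (rule LeastI_ex) (use Q in blast)
  then obtain P K where K: "power_dominating V E K" "card K \<le> spider_number V E"
    using spider_cover_dominating by metis
  let ?T = "repeat_mset (k + 1) (mset_set K)"
  have T: "robust_power_dominating V E k ?T" by (rule robust_repeat_mset[OF simple_graph K(1)])
  have "robust_power_domination_number V E k \<le> size ?T"
    unfolding robust_power_domination_number_def using T by (intro Least_le) blast
  also have "\<dots> \<le> (k + 1) * spider_number V E"
    using mult_le_mono2[OF K(2), of "k + 1"] by simp
  finally have upper: "robust_power_domination_number V E k \<le> (k + 1) * spider_number V E" .

  obtain S where S: "robust_power_dominating V E k S" "size S = robust_power_domination_number V E k"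
  proof -
    have "\<exists>S. robust_power_dominating V E k S \<and> size S = robust_power_domination_number V E k"
      unfolding robust_power_domination_number_def by (rule LeastI_ex) (use T in blast)
    with that show thesis by blast
  qed
  obtain s F where F: "\<And>v. v \<in> centers \<Longrightarrow> fort V E (F v)"
    and near: "\<And>v z. v \<in> centers \<Longrightarrow> z \<in> V \<Longrightarrow> closed_nbhd E z \<inter> F v \<noteq> {} \<Longrightarrow> s z = v"
    using packing_exists by metis
  \<comment> \<open>The fibre of \<open>s\<close> over \<open>v\<close> contains every vertex whose
    closed neighbourhood meets \<open>F v\<close>.\<close>
  have "k + 1 \<le> size (filter_mset (\<lambda>x. s x = v) S)" if v: "v \<in> centers" for v
    using robust_near_fort[OF simple_graph S(1) F[OF v], of "{x. s x = v}"] near[OF v] by simp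
  then have "(\<Sum>v\<in>centers. k + 1) \<le> (\<Sum>v\<in>centers. size (filter_mset (\<lambda>x. s x = v) S))"
    by (rule sum_mono)
  also have "\<dots> \<le> size S" by (rule sum_size_fibres_le[OF finC])
  finally have "(k + 1) * card centers \<le> size S" by (simp add: mult.commute)
  moreover have "(k + 1) * spider_number V E \<le> (k + 1) * card centers"
    using sp_le by (rule mult_le_mono2)
  ultimately show ?thesis using upper S(2) by linarith
qed

end
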